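(* Let $\rho\in[0,1)$, let $n$ be a positive integer, and let $\overline{x}=(\{i\rho\})_{i\ge1}$. The range $\{S(\rho,n,x): x\in[0,1)\}$ is an interval of length $nD_n(\overline{x})$.
   Context: $\{t\}=t-\lfloor t\rfloor$ denotes the fractional part. For a positive integer $n$ and $x\in[0,1)$, $S(\rho,n,x)=\sum_{i=1}^{n}\left(\{x+i\rho\}-\tfrac12\right)$. For a sequence $\overline{x}=(x_i)_{i\ge1}$ in $[0,1)$ (the model of the circle), the discrepancy of its first $n$ points is $D_n(\overline{x})=\sup_I\left(\frac{A(I,n)}{n}-\ell(I)\right)$, where $A(I,n)=\#\{1\le i\le n: x_i\in I\}$, $\ell(I)$ is the length (Lebesgue measure) of $I$, and $I$ ranges over all sets of the form $[a,b)\subseteq[0,1)$ and all complements in $[0,1)$ of such sets. Equivalently, $D_n(\overline{x})=\sup_{[a,b)\subseteq[0,1)}\left|\frac{A([a,b),n)}{n}-(b-a)\right|$. *)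

theory Defs
  imports "HOL-Analysis.Analysis"
begin

definition S :: "real \<Rightarrow> nat \<Rightarrow> real \<Rightarrow> real" where
  "S \<rho> n x = (\<Sum>i = 1..n. (frac (x + real i * \<rho>) - 1 / 2))"

text \<open>
  The circle is modelled by \<open>{0..<1}\<close>; its half-open arcs are the intervals \<open>{a..<b}\<close>
  contained in it and the complements of these.
\<close>
definition arcs :: "real set set" where
  "arcs = {{a..<b} | a b. {a..<b} \<subseteq> {0..<1}} \<union> {{0..<1} - {a..<b} | a b. {a..<b} \<subseteq> {0..<1}}"

text \<open>Sequences are indexed from 1; the value at 0 is never used.\<close>
definition count_in :: "(nat \<Rightarrow> real) \<Rightarrow> real set \<Rightarrow> nat \<Rightarrow> nat" where
  "count_in x I n = card {i \<in> {1..n}. x i \<in> I}"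

definition discrepancy :: "nat \<Rightarrow> (nat \<Rightarrow> real) \<Rightarrow> real" where
  "discrepancy n x = (SUP I\<in>arcs. real (count_in x I n) / real n - measure lborel I)"

end

(* On the circle, x \<mapsto> S \<rho> n x climbs with slope n and only ever jumps down, one unit for each
   i with x + i * \<rho> an integer. A function without upward jumps takes all intermediate values
   between a smaller value on the left and a larger one on the right; periodicity supplies the
   opposite order, so the range is an interval. Its length is the supremum of the differences of two
   values, and the jump count turns S \<rho> n x - S \<rho> n y for x \<le> y into
   n * (A(I, n) / n - l(I)) for the arc I = [1 - y, 1 - x), and S \<rho> n y - S \<rho> n x into the
   same expression for the complement of I. *)
theory Submission
  imports Defs
begin

section \<open>Right continuity of \<open>frac\<close> and an intermediate value theorem\<close>

lemma eventually_floor_eq_at_right: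
  fixes x :: real
  shows "\<forall>\<^sub>F t in at_right x. \<lfloor>t\<rfloor> = \<lfloor>x\<rfloor>"
  unfolding eventually_at_right_field
proof (intro exI conjI allI impI)
  show "x < of_int \<lfloor>x\<rfloor> + 1" by linarith
  show "\<lfloor>t\<rfloor> = \<lfloor>x\<rfloor>" if "x < t" "t < of_int \<lfloor>x\<rfloor> + 1" for t
    using that by linarith
qed

lemma tendsto_frac_at_right:
  fixes x :: real
  shows "(frac \<longlongrightarrow> frac x) (at_right x)"
proof (rule Lim_transform_eventually)
  show "((\<lambda>t. t - of_int \<lfloor>x\<rfloor>) \<longlongrightarrow> frac x) (at_right x)"
    unfolding frac_def by (intro tendsto_intros)
  show "\<forall>\<^sub>F t in at_right x. t - of_int \<lfloor>x\<rfloor> = frac t"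
    using eventually_floor_eq_at_right[of x] by eventually_elim (simp add: frac_def)
qed

text \<open>The last place where \<open>f\<close> is at most \<open>v\<close>, taken as a supremum,
  is the required point: the one-sided bound controls \<open>f\<close> there from the left, right
  continuity controls it from the right. Downward jumps are harmless.\<close>

lemma IVT_no_upward_jumps:
  fixes f :: "real \<Rightarrow> real"
  assumes upper: "\<And>s t. s \<le> t \<Longrightarrow> f t \<le> f s + L * (t - s)"
    and right: "\<And>t. (f \<longlongrightarrow> f t) (at_right t)"
    and "a \<le> b" "f a \<le> v" "v \<le> f b"
  obtains z where "a \<le> z" "z \<le> b" "f z = v"
proof -
  define T where "T = {t \<in> {a..b}. f t \<le> v}"
  have aT: "a \<in> T" and bdd: "bdd_above T"
    using assms unfolding T_def by (auto intro: bdd_aboveI[of _ b])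
  define z where "z = Sup T"
  have az: "a \<le> z"
    unfolding z_def using aT bdd by (rule cSup_upper)
  have zb: "z \<le> b"
    unfolding z_def using aT by (intro cSup_least) (auto simp: T_def)
  have "f z \<le> v"
  proof (rule field_le_epsilon)
    fix e :: real assume "e > 0"
    \<comment> \<open>The denominator is positive for every \<open>L\<close>, and the rise of
      \<open>f\<close> over a distance less than \<open>d\<close> is then at most
      \<open>e\<close>.\<close>
    define d where "d = e / (\<bar>L\<bar> + 1)"
    have "d > 0" using \<open>e > 0\<close> by (simp add: d_def)
    then have "z - d < Sup T" by (simp add: z_def)
    then obtain t where t: "t \<in> T" "z - d < t"
      using aT less_cSup_iff[OF _ bdd] by blast
    have "t \<le> z" unfolding z_def using t(1) bdd by (rule cSup_upper)
    have "L * (z - t) \<le> (\<bar>L\<bar> + 1) * d"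
      using \<open>t \<le> z\<close> t(2) by (intro mult_mono) auto
    also have "\<dots> = e" unfolding d_def by (simp add: field_simps)
    finally show "f z \<le> v + e"
      using upper[OF \<open>t \<le> z\<close>] t(1) by (simp add: T_def)
  qed
  moreover have "v \<le> f z"
  \<comment> \<open>At \<open>b\<close> the bound is a hypothesis. Elsewhere the points just right
    of \<open>z\<close> exceed the supremum of \<open>T\<close>, so \<open>f\<close> is above
    \<open>v\<close> there, and the bound passes to the right limit.\<close>
  proof (cases "z = b")
    case True
    then show ?thesis using assms by simp
  next
    case False
    then have "z < b" using zb by simp
    then have "\<forall>\<^sub>F t in at_right z. t < b"
      by (auto simp: eventually_at_right_field)
    then have "\<forall>\<^sub>F t in at_right z. v \<le> f t"
      using eventually_at_right_less[of z]
    proof eventually_elim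
      case (elim t)
      have "t \<notin> T" using cSup_upper[OF _ bdd, of t] elim(2) by (auto simp: z_def)
      then show ?case using elim az by (auto simp: T_def)
    qed
    then show ?thesis
      using right[of z] by (intro tendsto_lowerbound[where F = "at_right z"]) auto
  qed
  ultimately show thesis using that az zb by force
qed

section \<open>Differences of values and lengths of bounded intervals\<close>

lemma Sup_diff_eq:
  fixes A :: "real set"
  assumes "A \<noteq> {}" "bdd_above A" "bdd_below A"
  shows "Sup {u - v | u v. u \<in> A \<and> v \<in> A} = Sup A - Inf A"
proof (rule cSup_eq_non_empty)
  show "{u - v | u v. u \<in> A \<and> v \<in> A} \<noteq> {}" using assms by auto
  show "d \<le> Sup A - Inf A" if "d \<in> {u - v | u v. u \<in> A \<and> v \<in> A}" for d
    using that assms by (auto intro!: diff_mono cSup_upper cInf_lower)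
  show "Sup A - Inf A \<le> c"
    if c: "\<And>d. d \<in> {u - v | u v. u \<in> A \<and> v \<in> A} \<Longrightarrow> d \<le> c" for c
  proof -
    \<comment> \<open>The two extrema are taken one at a time: first over \<open>u\<close> with
      \<open>v\<close> fixed, then over \<open>v\<close>.\<close>
    have "Sup A - c \<le> v" if "v \<in> A" for v
    proof -
      have "Sup A \<le> c + v"
      proof (rule cSup_least[OF assms(1)])
        fix u assume "u \<in> A"
        then have "u - v \<le> c" using that by (intro c) blast
        then show "u \<le> c + v" by simp
      qed
      then show ?thesis by simp
    qed
    then have "Sup A - c \<le> Inf A" using assms(1) by (intro cInf_greatest)
    then show ?thesis by simp
  qed
qed

lemma measure_lborel_is_interval:
  fixes A :: "real set"
  assumes "is_interval A" "A \<noteq> {}" "bounded A"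
  shows "measure lborel A = Sup A - Inf A"
proof -
  define l u where "l = Inf A" and "u = Sup A"
  have bdd: "bdd_above A" "bdd_below A"
    using assms(3) bounded_imp_bdd_above bounded_imp_bdd_below by auto
  have sup: "A \<subseteq> {l..u}"
    unfolding l_def u_def using bdd by (auto intro: cSup_upper cInf_lower)
  have "l \<le> u" using sup assms(2) by force
  have sub: "{l<..<u} \<subseteq> A"
  proof
    fix x assume x: "x \<in> {l<..<u}"
    obtain a b where "a \<in> A" "a < x" "b \<in> A" "x < b"
      using x cInf_less_iff[OF assms(2) bdd(2)] less_cSup_iff[OF assms(2) bdd(1)]
      unfolding l_def u_def by auto
    then show "x \<in> A" using assms(1) unfolding is_interval_1 by (meson less_imp_le)
  qed
  \<comment> \<open>An open interval plus a finite set is Borel, so no case split on which endpoints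
    belong to \<open>A\<close> arises.\<close>
  have eq: "A = {l<..<u} \<union> (A \<inter> {l, u})" using sub sup by force
  have "{l<..<u} \<union> (A \<inter> {l, u}) \<in> sets borel"
    by (intro sets.Un borel_open borel_closed[OF finite_imp_closed]) auto
  then have meas: "A \<in> sets lborel" using eq by simp
  have fin: "{l..u} \<in> fmeasurable lborel" using fmeasurable_cbox[of l u] by simp
  have "A \<in> fmeasurable lborel"
    using fin sup meas by (rule fmeasurableI2)
  then have "measure lborel {l<..<u} \<le> measure lborel A"
    using sub by (intro measure_mono_fmeasurable) auto
  moreover have "measure lborel A \<le> measure lborel {l..u}"
    using sup meas fin by (rule measure_mono_fmeasurable)
  ultimately show ?thesis using \<open>l \<le> u\<close> by (simp add: l_def u_def)
qed

section \<open>The sawtooth sum \<open>S\<close> and its range\<close>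

lemma S_periodic: "S \<rho> n (x + 1) = S \<rho> n x"
  unfolding S_def by (intro sum.cong refl) (simp add: frac_def algebra_simps)

text \<open>Since \<open>floor\<close> is monotone, each summand rises with slope at most one. This
  is the one-sided bound in \<open>IVT_no_upward_jumps\<close>, with \<open>L\<close> equal to
  \<open>n\<close>.\<close>

lemma S_add_le:
  assumes "x \<le> y"
  shows "S \<rho> n y \<le> S \<rho> n x + real n * (y - x)"
proof -
  have "S \<rho> n y \<le> (\<Sum>i = 1..n. (frac (x + real i * \<rho>) - 1 / 2) + (y - x))"
    unfolding S_def
  proof (intro sum_mono)
    fix i
    have "\<lfloor>x + real i * \<rho>\<rfloor> \<le> \<lfloor>y + real i * \<rho>\<rfloor>"
      using assms by (intro floor_mono) simp
    then show "frac (y + real i * \<rho>) - 1 / 2 \<le> frac (x + real i * \<rho>) - 1 / 2 + (y - x)"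
      by (simp add: frac_def)
  qed
  then show ?thesis by (simp add: S_def sum.distrib)
qed

lemma S_tendsto_at_right: "(S \<rho> n \<longlongrightarrow> S \<rho> n x) (at_right x)"
proof -
  have "((\<lambda>t. frac (t + c)) \<longlongrightarrow> frac (x + c)) (at_right x)" for c :: real
    using tendsto_frac_at_right[of "x + c"]
    \<comment> \<open>Once both limits are moved to 0, the translation by \<open>c\<close> is only a
      matter of associativity.\<close>
    unfolding at_right_to_0[of "x + c"] at_right_to_0[of x] filterlim_filtermap
    by (simp add: add.assoc)
  then show ?thesis
    unfolding S_def by (intro tendsto_intros)
qed

lemma S_bounded: "\<bar>S \<rho> n x\<bar> \<le> real n"
proof -
  have "\<bar>S \<rho> n x\<bar> \<le> (\<Sum>i = 1..n. \<bar>frac (x + real i * \<rho>) - 1 / 2\<bar>)"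
    unfolding S_def by (rule sum_abs)
  also have "\<dots> \<le> (\<Sum>i = 1..n. 1)"
  proof (intro sum_mono)
    fix i
    show "\<bar>frac (x + real i * \<rho>) - 1 / 2\<bar> \<le> 1"
      using frac_ge_0[of "x + real i * \<rho>"] frac_lt_1[of "x + real i * \<rho>"] by linarith
  qed
  finally show ?thesis by simp
qed

text \<open>The closed interval is convenient later: the arc \<open>{1 - y..<1 - x}\<close> starts
  at 0 only when \<open>y = 1\<close>.\<close>

lemma S_image_closed: "S \<rho> n ` {0..1} = S \<rho> n ` {0..<1}"
proof -
  have "S \<rho> n 1 = S \<rho> n 0" using S_periodic[of \<rho> n 0] by simp
  moreover have "{0..1} = insert 1 {0..<(1::real)}" by auto
  ultimately show ?thesis by auto
qed

lemma S_image_UNIV: "range (S \<rho> n) = S \<rho> n ` {0..<1}"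
proof -
  have "S \<rho> n x = S \<rho> n (frac x)" for x
    unfolding S_def
  proof (intro sum.cong refl)
    fix i
    have "x + real i * \<rho> = frac x + real i * \<rho> + of_int \<lfloor>x\<rfloor>"
      by (simp add: frac_def)
    then have "frac (x + real i * \<rho>) = frac (frac x + real i * \<rho> + of_int \<lfloor>x\<rfloor>)"
      by (rule arg_cong)
    also have "\<dots> = frac (frac x + real i * \<rho>)"
      unfolding frac_def[of "_ + of_int _"] frac_def[of "frac x + _"] floor_add_int by simp
    finally show "frac (x + real i * \<rho>) - 1 / 2 = frac (frac x + real i * \<rho>) - 1 / 2"
      by simp
  qed
  moreover have "frac x \<in> {0..<1}" for x :: real by (simp add: frac_lt_1)
  ultimately show ?thesis by blast
qed

lemma S_is_interval: "is_interval (S \<rho> n ` {0..<1})"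
proof -
  have "v \<in> S \<rho> n ` {0..<1}"
    if xy: "x \<in> {0..<1}" "y \<in> {0..<1}" and v: "S \<rho> n x \<le> v" "v \<le> S \<rho> n y" for x y v
  proof -
    \<comment> \<open>If \<open>y\<close> lies to the left of \<open>x\<close>, one turn around the
      circle puts it on the right with the same value. The point found may then leave
      \<open>{0..<1}\<close>, hence the detour through the range on all reals.\<close>
    define y' where "y' = (if x \<le> y then y else y + 1)"
    have "x \<le> y'" "v \<le> S \<rho> n y'"
      using xy v by (auto simp: y'_def S_periodic)
    then obtain z where "S \<rho> n z = v"
      using IVT_no_upward_jumps[OF S_add_le S_tendsto_at_right _ v(1)] by metis
    then have "v \<in> range (S \<rho> n)" by (rule range_eqI[OF sym])
    then show ?thesis unfolding S_image_UNIV .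
  qed
  then show ?thesis by (auto simp only: is_interval_1)
qed

section \<open>Jumps of \<open>S\<close> as counts of points in arcs\<close>

lemma frac_add_diff:
  fixes x y t :: real
  assumes "0 \<le> x" "x \<le> y" "y \<le> 1"
  shows "frac (x + t) - frac (y + t) = of_bool (frac t \<in> {1 - y..<1 - x}) - (y - x)"
proof -
  \<comment> \<open>The last term is the carry past the next integer. The carries for
    \<open>x\<close> and \<open>y\<close> differ exactly when \<open>frac t\<close> is in
    \<open>{1 - y..<1 - x}\<close>.\<close>
  have "frac (z + t) = z + frac t - of_bool (1 - z \<le> frac t)" if "0 \<le> z" "z \<le> 1" for z
  proof (cases "1 - z \<le> frac t")
    case True
    then have "\<lfloor>z + t\<rfloor> = \<lfloor>t\<rfloor> + 1"
      using that frac_lt_1[of t] unfolding frac_def by linarith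
    then show ?thesis using True by (simp add: frac_def)
  next
    case False
    then have "\<lfloor>z + t\<rfloor> = \<lfloor>t\<rfloor>"
      using that unfolding frac_def by linarith
    then show ?thesis using False by (simp add: frac_def)
  qed
  then show ?thesis using assms by auto
qed

lemma S_diff_eq_count_in:
  assumes "0 \<le> x" "x \<le> y" "y \<le> 1"
  shows "S \<rho> n x - S \<rho> n y =
    real (count_in (\<lambda>i. frac (real i * \<rho>)) {1 - y..<1 - x} n) - real n * (y - x)"
proof -
  have "S \<rho> n x - S \<rho> n y = (\<Sum>i = 1..n. frac (x + real i * \<rho>) - frac (y + real i * \<rho>))"
    unfolding S_def sum_subtractf[symmetric] by simp
  also have "\<dots> =
      (\<Sum>i = 1..n. of_bool (frac (real i * \<rho>) \<in> {1 - y..<1 - x})) - real n * (y - x)"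
    unfolding frac_add_diff[OF assms] by (simp add: sum_subtractf)
  also have "(\<Sum>i = 1..n. of_bool (frac (real i * \<rho>) \<in> {1 - y..<1 - x}))
      = real (count_in (\<lambda>i. frac (real i * \<rho>)) {1 - y..<1 - x} n)"
    unfolding count_in_def by (simp add: sum_of_bool_eq Int_def)
  finally show ?thesis .
qed

lemma count_in_complement:
  assumes "\<And>i. x i \<in> X"
  shows "real (count_in x (X - I) n) = real n - real (count_in x I n)"
proof -
  let ?B = "{i \<in> {1..n}. x i \<in> I}"
  have "{i \<in> {1..n}. x i \<in> X - I} = {1..n} - ?B" using assms(1) by blast
  then have "count_in x (X - I) n = card ({1..n} - ?B)" unfolding count_in_def by (rule arg_cong)
  also have "\<dots> = card {1..n} - card ?B" by (rule card_Diff_subset) auto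
  finally have "count_in x (X - I) n = n - count_in x I n" unfolding count_in_def by simp
  moreover have "count_in x I n \<le> card {1..n}" unfolding count_in_def by (rule card_mono) auto
  ultimately show ?thesis by (simp add: of_nat_diff)
qed

text \<open>Arcs realise the differences with \<open>x\<close> left of \<open>y\<close>, complements
  the opposite ones: the whole circle has \<open>n\<close> points and length 1, so complementing
  flips the sign of the excess.\<close>

lemma arc_excess_set:
  "(\<lambda>I. real (count_in (\<lambda>i. frac (real i * \<rho>)) I n) - real n * measure lborel I) ` arcs
    = {u - v | u v. u \<in> S \<rho> n ` {0..<1} \<and> v \<in> S \<rho> n ` {0..<1}}"
    (is "?g ` arcs = ?D")
proof -
  have D: "?D = {S \<rho> n x - S \<rho> n y | x y. x \<in> {0..1} \<and> y \<in> {0..1}}"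
    unfolding S_image_closed[symmetric] by blast
  have arc: "?g {1 - y..<1 - x} = S \<rho> n x - S \<rho> n y"
    and co: "?g ({0..<1} - {1 - y..<1 - x}) = S \<rho> n y - S \<rho> n x"
    if "0 \<le> x" "x \<le> y" "y \<le> 1" for x y
  proof -
    let ?I = "{1 - y..<1 - x}"
    have sub: "?I \<subseteq> {0..<1}" using that by auto
    have len: "measure lborel ?I = y - x" using that by simp
    show "?g ?I = S \<rho> n x - S \<rho> n y"
      unfolding S_diff_eq_count_in[OF that] len by simp
    have colen: "measure lborel ({0..<1} - ?I) = 1 - (y - x)"
      using sub len by (subst measure_Diff) auto
    have "real (count_in (\<lambda>i. frac (real i * \<rho>)) ({0..<1} - ?I) n)
        = real n - real (count_in (\<lambda>i. frac (real i * \<rho>)) ?I n)"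
      by (rule count_in_complement) (simp add: frac_lt_1)
    then show "?g ({0..<1} - ?I) = S \<rho> n y - S \<rho> n x"
      using S_diff_eq_count_in[OF that, of \<rho> n] unfolding colen by (simp add: right_diff_distrib)
  qed
  show ?thesis
  proof (intro equalityI subsetI)
    fix d assume "d \<in> ?g ` arcs"
    then obtain a b where ab: "{a..<b} \<subseteq> {0..<(1::real)}"
      and d: "d = ?g {a..<b} \<or> d = ?g ({0..<1} - {a..<b})"
      unfolding arcs_def by blast
    obtain x y where xy: "0 \<le> x" "x \<le> y" "y \<le> 1" and I: "{a..<b} = {1 - y..<1 - x}"
    \<comment> \<open>A nonempty arc gives \<open>x = 1 - b\<close> and \<open>y = 1 - a\<close>.
      The endpoints of an empty one may lie outside the unit interval, so \<open>x = y = 0\<close>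
      is used instead.\<close>
    proof (cases "a < b")
      case True
      then have "0 \<le> a" "b \<le> 1" using atLeastLessThan_subset_iff[OF ab] by auto
      then show thesis using True that[of "1 - b" "1 - a"] by simp
    next
      case False
      then show thesis using that[of 0 0] by simp
    qed
    from d have "d = S \<rho> n x - S \<rho> n y \<or> d = S \<rho> n y - S \<rho> n x"
      unfolding I arc[OF xy] co[OF xy] .
    moreover have "x \<in> {0..1}" "y \<in> {0..1}" using xy by auto
    ultimately show "d \<in> ?D" unfolding D by blast
  next
    fix d assume "d \<in> ?D"
    then obtain x y where xy: "0 \<le> x" "x \<le> 1" "0 \<le> y" "y \<le> 1" and d: "d = S \<rho> n x - S \<rho> n y"
      unfolding D by auto
    show "d \<in> ?g ` arcs"
    proof (cases "x \<le> y")
      case True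
      have "{1 - y..<1 - x} \<subseteq> {0..<1}" using xy by auto
      then have "{1 - y..<1 - x} \<in> arcs" unfolding arcs_def by blast
      moreover have "d = ?g {1 - y..<1 - x}" using arc[OF xy(1) True xy(4)] d by simp
      ultimately show ?thesis by (rule rev_image_eqI)
    next
      case False
      then have "y \<le> x" by simp
      have "{1 - x..<1 - y} \<subseteq> {0..<1}" using xy by auto
      then have "{0..<1} - {1 - x..<1 - y} \<in> arcs" unfolding arcs_def by blast
      moreover have "d = ?g ({0..<1} - {1 - x..<1 - y})"
        using co[OF xy(3) \<open>y \<le> x\<close> xy(2)] d by simp
      ultimately show ?thesis by (rule rev_image_eqI)
    qed
  qed
qed

theorem theorem3p1:
  fixes \<rho> :: real and n :: nat
  assumes "\<rho> \<in> {0..<1}" and "n > 0"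
  shows "is_interval (S \<rho> n ` {0..<1})
       \<and> bounded (S \<rho> n ` {0..<1})
       \<and> measure lborel (S \<rho> n ` {0..<1}) = real n * discrepancy n (\<lambda>i. frac (real i * \<rho>))"
proof (intro conjI)
  let ?A = "S \<rho> n ` {0..<1}"
  let ?x = "\<lambda>i. frac (real i * \<rho>)"
  let ?D = "{u - v | u v. u \<in> ?A \<and> v \<in> ?A}"
  show int: "is_interval ?A" by (rule S_is_interval)
  show bnd: "bounded ?A" using S_bounded by (auto simp: bounded_iff)
  have ne: "?A \<noteq> {}" by simp
  have bdd: "bdd_above ?A" "bdd_below ?A"
    using bnd bounded_imp_bdd_above bounded_imp_bdd_below by auto
  \<comment> \<open>Each term of the discrepancy is an excess divided by \<open>n\<close>. Division
    by a positive \<open>n\<close> is monotone and continuous, so it commutes with the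
    supremum.\<close>
  have "(\<lambda>I. real (count_in ?x I n) / real n - measure lborel I) ` arcs = (\<lambda>d. d / real n) ` ?D"
    unfolding arc_excess_set[symmetric] image_image
    using assms(2) by (simp add: diff_divide_distrib)
  then have "discrepancy n ?x = (SUP d\<in>?D. d / real n)" by (simp add: discrepancy_def)
  also have "\<dots> = Sup ?D / real n"
  proof (rule continuous_at_Sup_mono[symmetric])
    show "mono (\<lambda>d. d / real n)" by (simp add: mono_def divide_right_mono)
    show "continuous (at_left (Sup ?D)) (\<lambda>d. d / real n)"
      using assms(2) by (intro continuous_intros) auto
    show "?D \<noteq> {}" using ne by blast
    show "bdd_above ?D"
    proof (rule bdd_aboveI)
      fix d assume "d \<in> ?D"
      then obtain u v where "u \<in> ?A" "v \<in> ?A" "d = u - v" by blast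
      then show "d \<le> Sup ?A - Inf ?A"
        using diff_mono[OF cSup_upper[OF _ bdd(1)] cInf_lower[OF _ bdd(2)]] by blast
    qed
  qed
  also have "Sup ?D = measure lborel ?A"
    using Sup_diff_eq[OF ne bdd] measure_lborel_is_interval[OF int ne bnd] by simp
  finally show "measure lborel ?A = real n * discrepancy n ?x" using assms(2) by simp
qed

end
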